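(* Let $X\subset\mathbb{C}$ be open, and let a smooth real-valued function $\omega$ on $X$ and a constant $Q\in\mathbb{C}^\times$ be a solution of Liouville's equation $-\omega_{z\bar z}=-2|Q|^2e^{-\omega}$. Suppose that this solution is of finite type $g$, and write the corresponding polynomial Killing field $\xi=\xi_z$ in the form $$\xi=\sum_{k=-g}^{1}\xi_k\lambda^k\quad\text{with}\quad\xi_k=\begin{pmatrix}u_k&\tau_ke^{\omega/2}\\\sigma_ke^{\omega/2}&-u_k\end{pmatrix},$$ where $u_k,\tau_k,\sigma_k$ are smooth complex-valued functions of $z$. Then $\tau_1=\tfrac14$, $u_1=\sigma_1=0$, and for every $k=0,-1,\dots,-g$: $$\tau_{k,z}=-\tfrac1{2Q}\bigl(u_{k,zz}-\omega_zu_{k,z}\bigr),\qquad\tau_{k,\bar z}=2\bar Qe^{-\omega}u_k,$$ $$u_{k-1}=2(\tau_{k,z}+\omega_z\tau_k),\qquad\sigma_{k-1}=-\tfrac1{\bar Q}u_{k-1,\bar z}.$$ Moreover every $u_k$ solves the linearisation of Liouville's equation: $$u_{k,z\bar z}+2|Q|^2e^{-\omega}u_k=0.$$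
   Context: For $\lambda\in\mathbb{C}$ let $$\alpha_\lambda=\frac14\begin{pmatrix}\omega_z&e^{\omega/2}\lambda\\-4Qe^{-\omega/2}&-\omega_z\end{pmatrix}dz+\frac14\begin{pmatrix}-\omega_{\bar z}&4\bar Qe^{-\omega/2}\\0&\omega_{\bar z}\end{pmatrix}d\bar z.$$ For an integer $g\ge0$ put $$\mathcal{P}^{\mathrm L}_g=\Bigl\{\zeta=\sum_{k=-g}^{1}\zeta_k\lambda^k\;\Big|\;\zeta_k\in\mathfrak{sl}(2,\mathbb{C}),\ \zeta_1\in\begin{pmatrix}0&\mathbb{R}^+\\0&0\end{pmatrix},\ \mathrm{tr}(\zeta_1\zeta_0)\ne0\Bigr\}.$$ The solution $(\omega,Q)$ is of finite type $g$ with corresponding polynomial Killing field $\xi$ if $\xi:X\to\mathcal{P}^{\mathrm L}_g$, $z\mapsto\xi_z$, is smooth, solves $d\xi+[\alpha_\lambda,\xi]=0$ (for all $\lambda$; $d$ is the differential in $z$) and satisfies the initial condition $\xi_1=\begin{pmatrix}0&\frac14e^{\omega/2}\\0&0\end{pmatrix}$. Subscripts $z,\bar z$ denote Wirtinger derivatives. By convention $u_{-g-1}=\tau_{-g-1}=\sigma_{-g-1}=0$. *)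

theory Defs
  imports "HOL-Analysis.Analysis"
begin

section \<open>Smooth functions and Wirtinger derivatives\<close>

text \<open>Derivatives are Frechet derivatives over the reals, so for functions on
  \<^typ>\<open>complex\<close> the notions below are those of the real plane. They are meant for open \<open>X\<close>.\<close>

primrec C_n_on :: "nat \<Rightarrow> ('a::real_normed_vector \<Rightarrow> 'b::real_normed_vector) \<Rightarrow> 'a set \<Rightarrow> bool" where
  "C_n_on 0 f X \<longleftrightarrow> continuous_on X f"
| "C_n_on (Suc n) f X \<longleftrightarrow>
     (\<forall>x\<in>X. f differentiable (at x)) \<and> (\<forall>v. C_n_on n (\<lambda>x. frechet_derivative f (at x) v) X)"

definition smooth_on :: "'a set \<Rightarrow> ('a::real_normed_vector \<Rightarrow> 'b::real_normed_vector) \<Rightarrow> bool" where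
  "smooth_on X f \<longleftrightarrow> (\<forall>n. C_n_on n f X)"

definition D_z :: "(complex \<Rightarrow> complex) \<Rightarrow> complex \<Rightarrow> complex" where
  "D_z f z = (frechet_derivative f (at z) 1 - \<i> * frechet_derivative f (at z) \<i>) / 2"

definition D_zbar :: "(complex \<Rightarrow> complex) \<Rightarrow> complex \<Rightarrow> complex" where
  "D_zbar f z = (frechet_derivative f (at z) 1 + \<i> * frechet_derivative f (at z) \<i>) / 2"


section \<open>Matrices\<close>

definition mat22 :: "'a \<Rightarrow> 'a \<Rightarrow> 'a \<Rightarrow> 'a \<Rightarrow> 'a::zero ^ 2 ^ 2" where
  "mat22 a b c d = vector [vector [a, b], vector [c, d]]"

text \<open>The library's \<open>*\<^sub>R\<close> and \<open>*s\<close> do not provide complex multiples of a matrix.\<close>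

definition smult_mat :: "complex \<Rightarrow> complex ^ 'n ^ 'm \<Rightarrow> complex ^ 'n ^ 'm"  (infixr "*\<^sub>M" 75) where
  "c *\<^sub>M A = (\<chi> i j. c * A $ i $ j)"

definition commutator :: "complex ^ 'n ^ 'n \<Rightarrow> complex ^ 'n ^ 'n \<Rightarrow> complex ^ 'n ^ 'n" where
  "commutator A B = A ** B - B ** A"


section \<open>Liouville's equation\<close>

definition liouville_solution :: "complex set \<Rightarrow> (complex \<Rightarrow> real) \<Rightarrow> complex \<Rightarrow> bool" where
  "liouville_solution X \<omega> Q \<longleftrightarrow>
     smooth_on X \<omega> \<and> Q \<noteq> 0 \<and>
     (\<forall>z\<in>X. - D_zbar (D_z (\<lambda>w. of_real (\<omega> w))) z = - 2 * of_real ((cmod Q)\<^sup>2 * exp (- \<omega> z)))"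

text \<open>The matrix-valued 1-form \<open>\<alpha>\<^sub>\<lambda>\<close>, with the spectral parameter \<open>\<lambda>\<close> written \<open>l\<close>,
  at the point \<open>z\<close>, applied to the tangent vector \<open>v\<close>; thus \<open>v\<close> and \<open>cnj v\<close> are the values of \<open>dz\<close> and of its conjugate.\<close>

definition alpha_form :: "(complex \<Rightarrow> real) \<Rightarrow> complex \<Rightarrow> complex \<Rightarrow> complex \<Rightarrow> complex \<Rightarrow> complex ^ 2 ^ 2" where
  "alpha_form \<omega> Q l z v =
     (v / 4) *\<^sub>M mat22
        (D_z (\<lambda>w. of_real (\<omega> w)) z)         (of_real (exp (\<omega> z / 2)) * l)
        (- 4 * Q * of_real (exp (- \<omega> z / 2))) (- D_z (\<lambda>w. of_real (\<omega> w)) z)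
   + (cnj v / 4) *\<^sub>M mat22
        (- D_zbar (\<lambda>w. of_real (\<omega> w)) z)     (4 * cnj Q * of_real (exp (- \<omega> z / 2)))
        0                                    (D_zbar (\<lambda>w. of_real (\<omega> w)) z)"


section \<open>Potentials and polynomial Killing fields\<close>

text \<open>A Laurent polynomial in \<open>\<lambda>\<close> (written \<open>l\<close>) is given by its family of coefficients,
  indexed by \<^typ>\<open>int\<close>.\<close>

definition potentials :: "nat \<Rightarrow> (int \<Rightarrow> complex ^ 2 ^ 2) set" where
  "potentials g = {\<zeta>.
     (\<forall>k. k \<notin> {- int g..1} \<longrightarrow> \<zeta> k = 0) \<and>
     (\<forall>k\<in>{- int g..1}. trace (\<zeta> k) = 0) \<and>
     (\<exists>r::real. r > 0 \<and> \<zeta> 1 = mat22 0 (of_real r) 0 0) \<and>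
     trace (\<zeta> 1 ** \<zeta> 0) \<noteq> 0}"

definition laurent_eval :: "nat \<Rightarrow> (int \<Rightarrow> complex ^ 2 ^ 2) \<Rightarrow> complex \<Rightarrow> complex ^ 2 ^ 2" where
  "laurent_eval g \<zeta> l = (\<Sum>k = - int g..1. (l powi k) *\<^sub>M \<zeta> k)"

text \<open>The pair \<open>(\<omega>, Q)\<close> is of finite type \<open>g\<close> with polynomial Killing field \<open>\<xi>\<close>. Smoothness of
  \<open>\<xi>\<close> as a map into a finite-dimensional space means smoothness of its coefficients. The
  normalisation in the last clause concerns the coefficient of \<open>\<lambda>\<close> (not the value of \<open>\<xi>\<close> at
  \<open>z = 1\<close>), and holds on all of \<open>X\<close>.\<close>

definition finite_type_with ::
  "complex set \<Rightarrow> (complex \<Rightarrow> real) \<Rightarrow> complex \<Rightarrow> nat \<Rightarrow> (complex \<Rightarrow> int \<Rightarrow> complex ^ 2 ^ 2) \<Rightarrow> bool" where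
  "finite_type_with X \<omega> Q g \<xi> \<longleftrightarrow>
     (\<forall>z\<in>X. \<xi> z \<in> potentials g) \<and>
     (\<forall>k\<in>{- int g..1}. smooth_on X (\<lambda>z. \<xi> z k)) \<and>
     (\<forall>l. l \<noteq> 0 \<longrightarrow> (\<forall>z\<in>X. \<forall>v.
        frechet_derivative (\<lambda>w. laurent_eval g (\<xi> w) l) (at z) v
        + commutator (alpha_form \<omega> Q l z v) (laurent_eval g (\<xi> z) l) = 0)) \<and>
     (\<forall>z\<in>X. \<xi> z 1 = mat22 0 (of_real (exp (\<omega> z / 2) / 4)) 0 0)"

end

theory Submission
  imports Defs
begin

text \<open>Comparing the coefficients of each power of \<open>\<lambda>\<close> and of \<open>dz\<close>, \<open>d(cnj z)\<close> in
  \<open>d\<xi> + [\<alpha>\<^sub>\<lambda>, \<xi>] = 0\<close> gives first-order equations for \<open>u\<^sub>k\<close>, \<open>\<tau>\<^sub>k\<close>, \<open>\<sigma>\<^sub>k\<close>; in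
  particular \<open>u\<^sub>k\<^sub>,\<^sub>z = - Q \<tau>\<^sub>k - e\<^sup>\<omega> \<sigma>\<^sub>k\<^sub>-\<^sub>1 / 4\<close>.
  Differentiating this identity once more in \<open>z\<close> and in \<open>cnj z\<close> and substituting the other
  equations gives the formula for \<open>\<tau>\<^sub>k\<^sub>,\<^sub>z\<close> and the linearised Liouville equation.\<close>

section \<open>Smooth functions\<close>

lemma frechet_derivative_linear_image:
  assumes "f differentiable at x" and "bounded_linear L"
  shows "frechet_derivative (\<lambda>x. L (f x)) (at x) v = L (frechet_derivative f (at x) v)"
  by (rule fun_cong[OF frechet_derivative_at[OF bounded_linear.has_derivative[OF assms(2)
          assms(1)[unfolded frechet_derivative_works]]], symmetric])

lemma frechet_derivative_mult:
  fixes f g :: "'a::real_normed_vector \<Rightarrow> 'b::real_normed_algebra"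
  assumes "f differentiable at x" and "g differentiable at x"
  shows "frechet_derivative (\<lambda>x. f x * g x) (at x) v =
    f x * frechet_derivative g (at x) v + frechet_derivative f (at x) v * g x"
  by (rule fun_cong[OF frechet_derivative_at[OF has_derivative_mult[OF
          assms[unfolded frechet_derivative_works]]], symmetric])

lemma frechet_derivative_add:
  assumes "f differentiable at x" and "g differentiable at x"
  shows "frechet_derivative (\<lambda>x. f x + g x) (at x) v =
    frechet_derivative f (at x) v + frechet_derivative g (at x) v"
  by (rule fun_cong[OF frechet_derivative_at[OF has_derivative_add[OF
          assms[unfolded frechet_derivative_works]]], symmetric])

lemma has_derivative_exp_compose:
  fixes f :: "'a::real_normed_vector \<Rightarrow> 'b::{banach, real_normed_field}"
  assumes "f differentiable at x"
  shows "((\<lambda>x. exp (f x)) has_derivative (\<lambda>v. frechet_derivative f (at x) v * exp (f x))) (at x)"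
  using has_derivative_compose[OF assms[unfolded frechet_derivative_works]
      DERIV_exp[of "f x", unfolded has_field_derivative_def]]
  by (simp add: mult.commute)

lemma frechet_derivative_exp_compose:
  fixes f :: "'a::real_normed_vector \<Rightarrow> 'b::{banach, real_normed_field}"
  assumes "f differentiable at x"
  shows "frechet_derivative (\<lambda>x. exp (f x)) (at x) v = frechet_derivative f (at x) v * exp (f x)"
  by (rule fun_cong[OF frechet_derivative_at[OF has_derivative_exp_compose[OF assms]], symmetric])

text \<open>The Leibniz rule for a derivative of order \<open>Suc n\<close> also contains the
  undifferentiated factors, and these must be known to be of class n. At the base the reason is that
  differentiability implies continuity.\<close>

lemma C_n_on_Suc_imp: "C_n_on (Suc n) f X \<Longrightarrow> C_n_on n f X"
proof (induction n arbitrary: f)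
  case 0
  then show ?case
    by (auto intro!: continuous_at_imp_continuous_on differentiable_imp_continuous_within)
next
  case (Suc n)
  then show ?case using C_n_on.simps(2)[of n f X] C_n_on.simps(2)[of "Suc n" f X] by blast
qed

text \<open>Derivatives at points of the open set \<open>X\<close> depend only on values in
  \<open>X\<close>. The inductions below rely on this: their derivative formulas hold only at points
  of \<open>X\<close>, while \<open>C_n_on\<close> speaks of functions on the whole space.\<close>

lemma C_n_on_cong:
  assumes "open X" and "\<And>x. x \<in> X \<Longrightarrow> f x = g x" and "C_n_on n f X"
  shows "C_n_on n g X"
  using assms(2,3)
proof (induction n arbitrary: f g)
  case 0
  then show ?case by (simp cong: continuous_on_cong)
next
  case (Suc n)
  have "g differentiable at x" if "x \<in> X" for x
    using Suc.prems that has_derivative_transform_within_open[OF _ \<open>open X\<close> that, of f _ UNIV g]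
    unfolding differentiable_def C_n_on.simps by blast
  moreover have "C_n_on n (\<lambda>x. frechet_derivative g (at x) v) X" for v
  proof (rule Suc.IH)
    show "C_n_on n (\<lambda>x. frechet_derivative f (at x) v) X"
      using Suc.prems by simp
    show "frechet_derivative f (at x) v = frechet_derivative g (at x) v" if "x \<in> X" for x
      using Suc.prems that frechet_derivative_transform_within_open[OF _ \<open>open X\<close> that, of f g]
      by simp
  qed
  ultimately show ?case by simp
qed

lemma C_n_on_linear_image:
  assumes "open X" and "bounded_linear L" and "C_n_on n f X"
  shows "C_n_on n (\<lambda>x. L (f x)) X"
  using assms(3)
proof (induction n arbitrary: f)
  case 0
  then show ?case by (simp add: bounded_linear.continuous_on[OF assms(2)])
next
  case (Suc n)
  have "(\<lambda>x. L (f x)) differentiable at x" if "x \<in> X" for x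
    using Suc.prems that bounded_linear.has_derivative[OF assms(2), of f _ "at x"]
    unfolding differentiable_def C_n_on.simps by blast
  moreover have "C_n_on n (\<lambda>x. frechet_derivative (\<lambda>x. L (f x)) (at x) v) X" for v
  proof (rule C_n_on_cong[OF \<open>open X\<close>])
    show "C_n_on n (\<lambda>x. L (frechet_derivative f (at x) v)) X"
      using Suc by simp
  qed (use Suc.prems assms(2) in \<open>simp add: frechet_derivative_linear_image\<close>)
  ultimately show ?case by simp
qed

lemma C_n_on_add:
  assumes "open X" and "C_n_on n f X" and "C_n_on n g X"
  shows "C_n_on n (\<lambda>x. f x + g x) X"
  using assms(2,3)
proof (induction n arbitrary: f g)
  case 0
  then show ?case by (simp add: continuous_on_add)
next
  case (Suc n)
  have "C_n_on n (\<lambda>x. frechet_derivative (\<lambda>x. f x + g x) (at x) v) X" for v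
  proof (rule C_n_on_cong[OF \<open>open X\<close>])
    show "C_n_on n (\<lambda>x. frechet_derivative f (at x) v + frechet_derivative g (at x) v) X"
      using Suc by simp
  qed (use Suc.prems in \<open>simp add: frechet_derivative_add\<close>)
  then show ?case using Suc.prems by simp
qed

text \<open>The Leibniz rule turns the derivative into a sum of two products of other functions, so
  the induction has to range over all pairs \<open>f\<close>, \<open>g\<close>.\<close>

lemma C_n_on_mult:
  fixes f g :: "'a::real_normed_vector \<Rightarrow> 'b::real_normed_algebra"
  assumes "open X" and "C_n_on n f X" and "C_n_on n g X"
  shows "C_n_on n (\<lambda>x. f x * g x) X"
  using assms(2,3)
proof (induction n arbitrary: f g)
  case 0
  then show ?case by (simp add: continuous_on_mult)
next
  case (Suc n)
  have "C_n_on n (\<lambda>x. frechet_derivative (\<lambda>x. f x * g x) (at x) v) X" for v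
  proof (rule C_n_on_cong[OF \<open>open X\<close>])
    show "C_n_on n (\<lambda>x. f x * frechet_derivative g (at x) v
        + frechet_derivative f (at x) v * g x) X"
      using Suc.prems by (intro C_n_on_add Suc.IH \<open>open X\<close>) (simp_all add: C_n_on_Suc_imp)
  qed (use Suc.prems in \<open>simp add: frechet_derivative_mult\<close>)
  then show ?case using Suc.prems by simp
qed

text \<open>The derivative of \<open>exp (f x)\<close> contains \<open>exp (f x)\<close> itself as a
  factor, so the induction runs with \<open>f\<close> fixed and the other factor is handled by
  \<open>C_n_on_mult\<close>.\<close>

lemma C_n_on_exp:
  fixes f :: "'a::real_normed_vector \<Rightarrow> 'b::{banach, real_normed_field}"
  assumes "open X" and "C_n_on n f X"
  shows "C_n_on n (\<lambda>x. exp (f x)) X"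
  using assms(2)
proof (induction n)
  case 0
  then show ?case by (simp add: continuous_on_exp)
next
  case (Suc n)
  have "(\<lambda>x. exp (f x)) differentiable at x" if "x \<in> X" for x
    using Suc.prems that has_derivative_exp_compose[of f x] by (auto simp: differentiable_def)
  moreover have "C_n_on n (\<lambda>x. frechet_derivative (\<lambda>x. exp (f x)) (at x) v) X" for v
  proof (rule C_n_on_cong[OF \<open>open X\<close>])
    show "C_n_on n (\<lambda>x. frechet_derivative f (at x) v * exp (f x)) X"
      using Suc by (intro C_n_on_mult \<open>open X\<close>) (simp_all add: C_n_on_Suc_imp)
  qed (use Suc.prems in \<open>simp add: frechet_derivative_exp_compose\<close>)
  ultimately show ?case by simp
qed

lemma smooth_on_cong:
  assumes "open X" and "smooth_on X f" and "\<And>x. x \<in> X \<Longrightarrow> f x = g x"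
  shows "smooth_on X g"
  using assms C_n_on_cong unfolding smooth_on_def by blast

lemma smooth_on_linear_image:
  "open X \<Longrightarrow> bounded_linear L \<Longrightarrow> smooth_on X f \<Longrightarrow> smooth_on X (\<lambda>x. L (f x))"
  by (simp add: smooth_on_def C_n_on_linear_image)

lemma smooth_on_mult:
  fixes f g :: "'a::real_normed_vector \<Rightarrow> 'b::real_normed_algebra"
  shows "open X \<Longrightarrow> smooth_on X f \<Longrightarrow> smooth_on X g \<Longrightarrow> smooth_on X (\<lambda>x. f x * g x)"
  by (simp add: smooth_on_def C_n_on_mult)

lemma smooth_on_exp:
  fixes f :: "'a::real_normed_vector \<Rightarrow> 'b::{banach, real_normed_field}"
  shows "open X \<Longrightarrow> smooth_on X f \<Longrightarrow> smooth_on X (\<lambda>x. exp (f x))"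
  by (simp add: smooth_on_def C_n_on_exp)

lemma smooth_on_imp_differentiable: "smooth_on X f \<Longrightarrow> x \<in> X \<Longrightarrow> f differentiable at x"
  unfolding smooth_on_def using C_n_on.simps(2)[of 0 f X] by blast

section \<open>Wirtinger derivatives\<close>

text \<open>Differentiability need not be assumed: \<open>frechet_derivative\<close> is a choice
  among all \<open>D\<close> satisfying \<open>has_derivative\<close>. The two functions have the
  same such \<open>D\<close>, so the chosen values agree even when there is none.\<close>

lemma frechet_derivative_cong_open:
  assumes "open X" and "z \<in> X" and "\<And>w. w \<in> X \<Longrightarrow> f w = g w"
  shows "frechet_derivative f (at z) = frechet_derivative g (at z)"
proof -
  have "(f has_derivative D) (at z) \<longleftrightarrow> (g has_derivative D) (at z)" for D
    using has_derivative_transform_within_open[OF _ assms(1,2), of f D UNIV g]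
      has_derivative_transform_within_open[OF _ assms(1,2), of g D UNIV f] assms(3) by auto
  then show ?thesis by (simp add: frechet_derivative_def)
qed

lemma D_z_cong_open:
  assumes "open X" and "z \<in> X" and "\<And>w. w \<in> X \<Longrightarrow> f w = g w"
  shows "D_z f z = D_z g z"
  by (simp add: D_z_def frechet_derivative_cong_open[OF assms])

lemma D_zbar_cong_open:
  assumes "open X" and "z \<in> X" and "\<And>w. w \<in> X \<Longrightarrow> f w = g w"
  shows "D_zbar f z = D_zbar g z"
  by (simp add: D_zbar_def frechet_derivative_cong_open[OF assms])

lemma D_z_const [simp]: "D_z (\<lambda>w. c) z = 0"
  by (simp add: D_z_def)

lemma D_zbar_const [simp]: "D_zbar (\<lambda>w. c) z = 0"
  by (simp add: D_zbar_def)

lemma D_z_add: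
  assumes "f differentiable at z" and "g differentiable at z"
  shows "D_z (\<lambda>w. f w + g w) z = D_z f z + D_z g z"
  by (simp add: D_z_def frechet_derivative_add[OF assms] field_simps)

lemma D_zbar_add:
  assumes "f differentiable at z" and "g differentiable at z"
  shows "D_zbar (\<lambda>w. f w + g w) z = D_zbar f z + D_zbar g z"
  by (simp add: D_zbar_def frechet_derivative_add[OF assms] field_simps)

lemma D_z_mult:
  assumes "f differentiable at z" and "g differentiable at z"
  shows "D_z (\<lambda>w. f w * g w) z = f z * D_z g z + D_z f z * g z"
  by (simp add: D_z_def frechet_derivative_mult[OF assms] field_simps)

lemma D_zbar_mult:
  assumes "f differentiable at z" and "g differentiable at z"
  shows "D_zbar (\<lambda>w. f w * g w) z = f z * D_zbar g z + D_zbar f z * g z"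
  by (simp add: D_zbar_def frechet_derivative_mult[OF assms] field_simps)

lemma D_z_cmult:
  assumes "f differentiable at z"
  shows "D_z (\<lambda>w. c * f w) z = c * D_z f z"
  using D_z_mult[OF differentiable_const assms] by simp

lemma D_zbar_cmult:
  assumes "f differentiable at z"
  shows "D_zbar (\<lambda>w. c * f w) z = c * D_zbar f z"
  using D_zbar_mult[OF differentiable_const assms] by simp

lemma D_z_exp:
  assumes "f differentiable at z"
  shows "D_z (\<lambda>w. exp (f w)) z = D_z f z * exp (f z)"
  by (simp add: D_z_def frechet_derivative_exp_compose[OF assms] field_simps)

lemma D_zbar_exp:
  assumes "f differentiable at z"
  shows "D_zbar (\<lambda>w. exp (f w)) z = D_zbar f z * exp (f z)"
  by (simp add: D_zbar_def frechet_derivative_exp_compose[OF assms] field_simps)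

text \<open>The Wirtinger derivatives are the coefficients of dz and of its conjugate in the real
  differential: in the combination of the values at 1 and \<i> the \<open>q\<close> terms cancel.
  With \<open>D_zbar_eq\<close> this reads off both derivatives from an equation for the
  differential.\<close>

lemma D_z_eq:
  assumes "\<And>v. frechet_derivative f (at z) v = v * p + cnj v * q"
  shows "D_z f z = p"
  by (simp add: D_z_def assms field_simps)

lemma D_zbar_eq:
  assumes "\<And>v. frechet_derivative f (at z) v = v * p + cnj v * q"
  shows "D_zbar f z = q"
  by (simp add: D_zbar_def assms field_simps)

section \<open>Laurent polynomials\<close>

text \<open>Multiplication by \<open>l powi (- m)\<close> turns the sum into an ordinary polynomial
  that vanishes for all nonzero \<open>l\<close>, and a polynomial vanishing everywhere has zero
  coefficients.\<close>

lemma laurent_coeffs_eq_0: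
  fixes c :: "int \<Rightarrow> complex"
  assumes zero: "\<And>l. l \<noteq> 0 \<Longrightarrow> (\<Sum>k=m..n. l powi k * c k) = 0" and k: "k \<in> {m..n}"
  shows "c k = 0"
proof -
  define N where "N = nat (n - m)"
  have "(\<Sum>i\<le>N. c (m + int i) * l ^ i) = 0" if l: "l \<noteq> 0" for l
  proof -
    have "(\<Sum>i\<le>N. c (m + int i) * l ^ i) = (\<Sum>k=m..n. l powi (- m) * (l powi k * c k))"
      by (rule sum.reindex_bij_witness[of _ "\<lambda>k. nat (k - m)" "\<lambda>i. m + int i"])
        (use k l in \<open>auto simp: N_def power_int_add power_int_minus field_simps\<close>)
    then show ?thesis
      by (simp add: zero[OF l] flip: sum_distrib_left)
  qed
  \<comment> \<open>One further factor \<open>l\<close> makes the polynomial vanish at \<open>0\<close> as well.\<close>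
  moreover define d where "d i = (if i = 0 then 0 else c (m + int (i - 1)))" for i
  ultimately have "(\<Sum>i\<le>Suc N. d i * l ^ i) = 0" for l
    by (cases "l = 0") (simp_all add: sum.atMost_Suc_shift mult.left_commute[of _ l]
        del: sum.atMost_Suc flip: sum_distrib_left)
  then have "d (Suc (nat (k - m))) = 0"
    by (rule zero_polynom_imp_zero_coeffs[where n = "Suc N"]) (use k in \<open>simp add: N_def nat_mono\<close>)
  then show ?thesis
    using k by (simp add: d_def)
qed

text \<open>Comparison of coefficients when one term carries an extra factor \<open>l\<close>, as
  happens with the upper right entry of \<alpha>: that factor pairs the coefficient of index k with
  the one of index k - 1. The value \<open>h (m - 1) = 0\<close> makes the lowest power fit the same
  pattern.\<close>

lemma laurent_coeffs_shift_eq_0: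
  fixes f h :: "int \<Rightarrow> complex"
  assumes zero: "\<And>l. l \<noteq> 0 \<Longrightarrow>
      (\<Sum>k=m..n. l powi k * f k) + l * (\<Sum>k=m..n. l powi k * h k) = 0"
    and h: "h (m - 1) = 0" and k: "k \<in> {m..n}"
  shows "f k + h (k - 1) = 0"
proof -
  \<comment> \<open>The combined Laurent polynomial reaches up to the power n + 1, where only
    \<open>h n\<close> contributes; \<open>f\<close> is cut off there because its value at n + 1
    does not enter the given sums.\<close>
  define c where "c k = (if k \<le> n then f k else 0) + h (k - 1)" for k
  have "(\<Sum>k=m..n+1. l powi k * c k) = 0" if l: "l \<noteq> 0" for l
  proof -
    have "(\<Sum>k=m..n+1. l powi k * (if k \<le> n then f k else 0)) = (\<Sum>k=m..n. l powi k * f k)"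
      by (rule sum.mono_neutral_cong_right) auto
    moreover have "(\<Sum>k=m..n+1. l powi k * h (k - 1)) = (\<Sum>k=m-1..n. l * (l powi k * h k))"
      by (rule sum.reindex_bij_witness[of _ "\<lambda>k. k + 1" "\<lambda>k. k - 1"])
        (use l in \<open>auto simp: power_int_diff\<close>)
    moreover have "(\<Sum>k=m-1..n. l * (l powi k * h k)) = (\<Sum>k=m..n. l * (l powi k * h k))"
    proof (rule sum.mono_neutral_right)
      show "\<forall>i\<in>{m - 1..n} - {m..n}. l * (l powi i * h i) = 0"
      proof
        fix i assume "i \<in> {m - 1..n} - {m..n}"
        then have "i = m - 1" by auto
        then show "l * (l powi i * h i) = 0" using h by simp
      qed
    qed auto
    ultimately show ?thesis
      using zero[OF l] by (simp add: c_def ring_distribs sum.distrib sum_distrib_left)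
  qed
  then have "c k = 0"
    by (rule laurent_coeffs_eq_0[where m = m and n = "n + 1"]) (use k in auto)
  then show ?thesis
    using k by (simp add: c_def)
qed

section \<open>Matrix entries\<close>

lemma mat22_nth [simp]:
  "mat22 a b c d $ 1 $ 1 = a" "mat22 a b c d $ 1 $ 2 = b"
  "mat22 a b c d $ 2 $ 1 = c" "mat22 a b c d $ 2 $ 2 = d"
  by (simp_all add: mat22_def)

lemma commutator_nth:
  fixes A B :: "complex ^ 2 ^ 2"
  shows "commutator A B $ i $ j =
    A $ i $ 1 * B $ 1 $ j + A $ i $ 2 * B $ 2 $ j - (B $ i $ 1 * A $ 1 $ j + B $ i $ 2 * A $ 2 $ j)"
  by (simp add: commutator_def matrix_matrix_mult_def sum_2)

lemma laurent_eval_nth: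
  "laurent_eval g \<zeta> l $ i $ j = (\<Sum>k=-int g..1. l powi k * \<zeta> k $ i $ j)"
  by (simp add: laurent_eval_def smult_mat_def)

lemma bounded_linear_entry: "bounded_linear (\<lambda>M :: 'a::real_normed_vector ^ 'n ^ 'm. M $ i $ j)"
  by (rule bounded_linear_compose[OF bounded_linear_vec_nth bounded_linear_vec_nth])

lemma bounded_linear_smult_mat: "bounded_linear (\<lambda>M. c *\<^sub>M M)"
  unfolding linear_conv_bounded_linear[symmetric]
  by (rule linearI) (simp_all add: smult_mat_def vec_eq_iff algebra_simps)

text \<open>For fixed \<open>l\<close> the evaluation and the passage to an entry are linear in the
  coefficients, so both commute with the differential.\<close>

lemma frechet_derivative_laurent_eval_nth:
  assumes "\<And>k. k \<in> {-int g..1} \<Longrightarrow> (\<lambda>w. \<xi> w k) differentiable at z"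
  shows "frechet_derivative (\<lambda>w. laurent_eval g (\<xi> w) l) (at z) v $ i $ j =
    (\<Sum>k=-int g..1. l powi k * frechet_derivative (\<lambda>w. \<xi> w k $ i $ j) (at z) v)"
proof -
  have "((\<lambda>w. laurent_eval g (\<xi> w) l) has_derivative
      (\<lambda>v. \<Sum>k=-int g..1. (l powi k) *\<^sub>M frechet_derivative (\<lambda>w. \<xi> w k) (at z) v)) (at z)"
    unfolding laurent_eval_def using assms
    by (intro has_derivative_sum bounded_linear.has_derivative[OF bounded_linear_smult_mat])
      (simp add: frechet_derivative_works)
  from fun_cong[OF frechet_derivative_at[OF this], of v, symmetric] show ?thesis
    using assms
    by (simp add: smult_mat_def frechet_derivative_linear_image[OF _ bounded_linear_entry])
qed

text \<open>The real exponentials are rewritten as complex exponentials of \<open>W\<close>, so that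
  all later calculus takes place among complex-valued functions.\<close>

lemma alpha_form_nth:
  fixes \<omega> Q l z v
  defines "W \<equiv> \<lambda>w. complex_of_real (\<omega> w)"
  shows
    "alpha_form \<omega> Q l z v $ 1 $ 1 = (v * D_z W z - cnj v * D_zbar W z) / 4"
    "alpha_form \<omega> Q l z v $ 1 $ 2 = v * exp (W z / 2) * l / 4 + cnj v * cnj Q * exp (- W z / 2)"
    "alpha_form \<omega> Q l z v $ 2 $ 1 = - v * Q * exp (- W z / 2)"
    "alpha_form \<omega> Q l z v $ 2 $ 2 = - ((v * D_z W z - cnj v * D_zbar W z) / 4)"
proof -
  have exps: "complex_of_real (exp (\<omega> z / 2)) = exp (W z / 2)"
    "complex_of_real (exp (- \<omega> z / 2)) = exp (- W z / 2)"
    by (simp_all add: W_def flip: exp_of_real)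
  show
    "alpha_form \<omega> Q l z v $ 1 $ 1 = (v * D_z W z - cnj v * D_zbar W z) / 4"
    "alpha_form \<omega> Q l z v $ 1 $ 2 = v * exp (W z / 2) * l / 4 + cnj v * cnj Q * exp (- W z / 2)"
    "alpha_form \<omega> Q l z v $ 2 $ 1 = - v * Q * exp (- W z / 2)"
    "alpha_form \<omega> Q l z v $ 2 $ 2 = - ((v * D_z W z - cnj v * D_zbar W z) / 4)"
    unfolding alpha_form_def smult_mat_def exps W_def[symmetric]
    by (simp_all add: diff_divide_distrib)
qed

section \<open>The coefficient equations\<close>

text \<open>The three equations come from one power of \<lambda> in the Killing equation, entry by
  entry. Each right-hand side is arranged as \<open>v\<close> times a term plus \<open>cnj v\<close>
  times a term, ready for \<open>D_z_eq\<close> and \<open>D_zbar_eq\<close>. The (2,2) entry is the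
  negative of the (1,1) entry since the coefficients are traceless.\<close>

lemma Killing_field_coefficient_equations:
  fixes \<omega> :: "complex \<Rightarrow> real" and \<xi> :: "complex \<Rightarrow> int \<Rightarrow> complex ^ 2 ^ 2"
  defines "W \<equiv> \<lambda>w. complex_of_real (\<omega> w)"
  assumes \<xi>: "finite_type_with X \<omega> Q g \<xi>" and z: "z \<in> X" and k: "k \<in> {- int g..1}"
  shows
    "frechet_derivative (\<lambda>w. \<xi> w k $ 1 $ 1) (at z) v =
       v * (- Q * exp (- W z / 2) * \<xi> z k $ 1 $ 2 - exp (W z / 2) / 4 * \<xi> z (k - 1) $ 2 $ 1)
       + cnj v * (- cnj Q * exp (- W z / 2) * \<xi> z k $ 2 $ 1)" (is ?th11)
    "frechet_derivative (\<lambda>w. \<xi> w k $ 1 $ 2) (at z) v =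
       v * (exp (W z / 2) / 4 * (\<xi> z (k - 1) $ 1 $ 1 - \<xi> z (k - 1) $ 2 $ 2)
         - D_z W z / 2 * \<xi> z k $ 1 $ 2)
       + cnj v * (D_zbar W z / 2 * \<xi> z k $ 1 $ 2
         + cnj Q * exp (- W z / 2) * (\<xi> z k $ 1 $ 1 - \<xi> z k $ 2 $ 2))" (is ?th12)
    "frechet_derivative (\<lambda>w. \<xi> w k $ 2 $ 1) (at z) v =
       v * (D_z W z / 2 * \<xi> z k $ 2 $ 1
         + Q * exp (- W z / 2) * (\<xi> z k $ 1 $ 1 - \<xi> z k $ 2 $ 2))
       + cnj v * (- D_zbar W z / 2 * \<xi> z k $ 2 $ 1)" (is ?th21)
proof -
  have diff: "(\<lambda>w. \<xi> w k) differentiable at z" if "k \<in> {- int g..1}" for k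
    using \<xi> z that by (auto simp: finite_type_with_def intro: smooth_on_imp_differentiable)
  \<comment> \<open>This supplies \<open>h (m - 1) = 0\<close> for the shifted comparison of
    coefficients, with \<open>m\<close> the lowest index.\<close>
  have below: "\<xi> z (- int g - 1) = 0"
    using \<xi> z by (auto simp: finite_type_with_def potentials_def)
  \<comment> \<open>With these names \<alpha> has rows (p, e l + q) and (r, - p). Only
    \<open>e\<close> comes with a factor \<open>l\<close>, so only the terms with \<open>e\<close>
    refer to the index k - 1.\<close>
  define p where "p = (v * D_z W z - cnj v * D_zbar W z) / 4"
  define q where "q = cnj v * cnj Q * exp (- W z / 2)"
  define e where "e = v * exp (W z / 2) / 4"
  define r where "r = - v * Q * exp (- W z / 2)"
  define d where "d i j k = frechet_derivative (\<lambda>w. \<xi> w k $ i $ j) (at z) v" for i j k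
  have entry: "(\<Sum>k=-int g..1. l powi k * d i j k)
      + commutator (alpha_form \<omega> Q l z v) (laurent_eval g (\<xi> z) l) $ i $ j = 0"
    if "l \<noteq> 0" for l i j
  proof -
    have "frechet_derivative (\<lambda>w. laurent_eval g (\<xi> w) l) (at z) v
        + commutator (alpha_form \<omega> Q l z v) (laurent_eval g (\<xi> z) l) = 0"
      using \<xi> z that by (auto simp: finite_type_with_def)
    from arg_cong[OF this, of "\<lambda>M. M $ i $ j"] show ?thesis
      using frechet_derivative_laurent_eval_nth[where g = g and \<xi> = \<xi>, OF diff, of l v i j]
      by (simp add: d_def)
  qed
  have alpha: "alpha_form \<omega> Q l z v $ 1 $ 1 = p" "alpha_form \<omega> Q l z v $ 1 $ 2 = e * l + q"
    "alpha_form \<omega> Q l z v $ 2 $ 1 = r" "alpha_form \<omega> Q l z v $ 2 $ 2 = - p" for l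
    by (simp_all add: alpha_form_nth p_def q_def e_def r_def W_def)
  have sum_powi_distribs:
    "(\<Sum>k=-int g..1. l powi k * (x k + y k)) =
      (\<Sum>k=-int g..1. l powi k * x k) + (\<Sum>k=-int g..1. l powi k * y k)"
    "(\<Sum>k=-int g..1. l powi k * (x k - y k)) =
      (\<Sum>k=-int g..1. l powi k * x k) - (\<Sum>k=-int g..1. l powi k * y k)"
    "(\<Sum>k=-int g..1. l powi k * (b * x k)) = b * (\<Sum>k=-int g..1. l powi k * x k)"
    for l b :: complex and x y
    by (simp_all add: distrib_left right_diff_distrib sum.distrib sum_subtractf sum_distrib_left
        mult.left_commute)
  note expand = commutator_nth alpha laurent_eval_nth
  \<comment> \<open>The diagonal terms with \<open>p\<close> cancel in the (1,1) entry of the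
    commutator; what remains is the upper right entry of \<alpha> times the lower left of \<xi>,
    minus the product of the other two off-diagonal entries.\<close>
  have "(d 1 1 k + q * \<xi> z k $ 2 $ 1 - r * \<xi> z k $ 1 $ 2) + e * \<xi> z (k - 1) $ 2 $ 1 = 0"
  proof (rule laurent_coeffs_shift_eq_0[where h = "\<lambda>k. e * \<xi> z k $ 2 $ 1"
        and f = "\<lambda>k. d 1 1 k + q * \<xi> z k $ 2 $ 1 - r * \<xi> z k $ 1 $ 2", OF _ _ k])
    show "(\<Sum>k=-int g..1. l powi k * (d 1 1 k + q * \<xi> z k $ 2 $ 1 - r * \<xi> z k $ 1 $ 2))
        + l * (\<Sum>k=-int g..1. l powi k * (e * \<xi> z k $ 2 $ 1)) = 0" if "l \<noteq> 0" for l
      using entry[OF that, of 1 1] unfolding sum_powi_distribs expand by (simp add: algebra_simps)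
  qed (simp add: below)
  then have "d 1 1 k = r * \<xi> z k $ 1 $ 2 - q * \<xi> z k $ 2 $ 1 - e * \<xi> z (k - 1) $ 2 $ 1"
    by algebra
  then show ?th11
    by (simp add: d_def q_def e_def r_def algebra_simps)
  have "(d 1 2 k + 2 * p * \<xi> z k $ 1 $ 2 - q * (\<xi> z k $ 1 $ 1 - \<xi> z k $ 2 $ 2))
      + - e * (\<xi> z (k - 1) $ 1 $ 1 - \<xi> z (k - 1) $ 2 $ 2) = 0"
  proof (rule laurent_coeffs_shift_eq_0[where h = "\<lambda>k. - e * (\<xi> z k $ 1 $ 1 - \<xi> z k $ 2 $ 2)"
        and f = "\<lambda>k. d 1 2 k + 2 * p * \<xi> z k $ 1 $ 2 - q * (\<xi> z k $ 1 $ 1 - \<xi> z k $ 2 $ 2)",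
        OF _ _ k])
    show "(\<Sum>k=-int g..1. l powi k *
          (d 1 2 k + 2 * p * \<xi> z k $ 1 $ 2 - q * (\<xi> z k $ 1 $ 1 - \<xi> z k $ 2 $ 2)))
        + l * (\<Sum>k=-int g..1. l powi k * (- e * (\<xi> z k $ 1 $ 1 - \<xi> z k $ 2 $ 2))) = 0"
      if "l \<noteq> 0" for l
      using entry[OF that, of 1 2] unfolding sum_powi_distribs expand by (simp add: algebra_simps)
  qed (simp add: below)
  then have "d 1 2 k = q * (\<xi> z k $ 1 $ 1 - \<xi> z k $ 2 $ 2) - 2 * p * \<xi> z k $ 1 $ 2
      + e * (\<xi> z (k - 1) $ 1 $ 1 - \<xi> z (k - 1) $ 2 $ 2)"
    by algebra
  then show ?th12
    by (simp add: d_def p_def q_def e_def field_simps)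
  \<comment> \<open>The upper right entry of \<alpha> does not occur in the (2,1) entry of the
    commutator, so no power of \<lambda> is shifted and \<open>h\<close> is zero.\<close>
  have "(d 2 1 k + r * (\<xi> z k $ 1 $ 1 - \<xi> z k $ 2 $ 2) - 2 * p * \<xi> z k $ 2 $ 1) + 0 = 0"
  proof (rule laurent_coeffs_shift_eq_0[where h = "\<lambda>_. 0"
        and f = "\<lambda>k. d 2 1 k + r * (\<xi> z k $ 1 $ 1 - \<xi> z k $ 2 $ 2) - 2 * p * \<xi> z k $ 2 $ 1",
        OF _ _ k])
    show "(\<Sum>k=-int g..1. l powi k *
          (d 2 1 k + r * (\<xi> z k $ 1 $ 1 - \<xi> z k $ 2 $ 2) - 2 * p * \<xi> z k $ 2 $ 1))
        + l * (\<Sum>k=-int g..1. l powi k * 0) = 0" if "l \<noteq> 0" for l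
      using entry[OF that, of 2 1] unfolding sum_powi_distribs expand by (simp add: algebra_simps)
  qed simp
  then have "d 2 1 k = 2 * p * \<xi> z k $ 2 $ 1 - r * (\<xi> z k $ 1 $ 1 - \<xi> z k $ 2 $ 2)"
    by algebra
  then show ?th21
    by (simp add: d_def p_def r_def field_simps)
qed

section \<open>The recursion\<close>

theorem proposition3p2:
  fixes X :: "complex set" and \<omega> :: "complex \<Rightarrow> real" and Q :: complex and g :: nat
    and \<xi> :: "complex \<Rightarrow> int \<Rightarrow> complex ^ 2 ^ 2"
    and u \<tau> \<sigma> :: "int \<Rightarrow> complex \<Rightarrow> complex"
  assumes "open X"
    and "liouville_solution X \<omega> Q"
    and "finite_type_with X \<omega> Q g \<xi>"
    and form: "\<And>k z. k \<in> {- int g..1} \<Longrightarrow> z \<in> X \<Longrightarrow>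
      \<xi> z k = mat22 (u k z) (\<tau> k z * of_real (exp (\<omega> z / 2)))
                    (\<sigma> k z * of_real (exp (\<omega> z / 2))) (- u k z)"
    and convention: "\<And>z. z \<in> X \<Longrightarrow> u (- int g - 1) z = 0"
      "\<And>z. z \<in> X \<Longrightarrow> \<tau> (- int g - 1) z = 0"
      "\<And>z. z \<in> X \<Longrightarrow> \<sigma> (- int g - 1) z = 0"
  shows "(\<forall>k\<in>{- int g..1}. smooth_on X (u k) \<and> smooth_on X (\<tau> k) \<and> smooth_on X (\<sigma> k)) \<and>
    (\<forall>z\<in>X. \<tau> 1 z = 1 / 4 \<and> u 1 z = 0 \<and> \<sigma> 1 z = 0) \<and>
    (\<forall>k\<in>{- int g..0}. \<forall>z\<in>X.
       D_z (\<tau> k) z = - (1 / (2 * Q)) *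
         (D_z (D_z (u k)) z - D_z (\<lambda>w. of_real (\<omega> w)) z * D_z (u k) z) \<and>
       D_zbar (\<tau> k) z = 2 * cnj Q * of_real (exp (- \<omega> z)) * u k z \<and>
       u (k - 1) z = 2 * (D_z (\<tau> k) z + D_z (\<lambda>w. of_real (\<omega> w)) z * \<tau> k z) \<and>
       \<sigma> (k - 1) z = - (1 / cnj Q) * D_zbar (u (k - 1)) z) \<and>
    (\<forall>k\<in>{- int g..1}. \<forall>z\<in>X.
       D_zbar (D_z (u k)) z + 2 * of_real ((cmod Q)\<^sup>2 * exp (- \<omega> z)) * u k z = 0)"
proof -
  \<comment> \<open>\<open>?K'\<close> adds the index below the lowest one: at k = - g the recursion
    refers to k - 1 = - g - 1, where the convention sets the coefficients to zero.\<close>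
  let ?K = "{- int g..1}" and ?K' = "{- int g - 1..1}"
  define W where "W = (\<lambda>w. complex_of_real (\<omega> w))"
  have W_apply: "complex_of_real (\<omega> w) = W w" for w
    by (simp add: W_def)
  have Q: "Q \<noteq> 0" and smooth_\<omega>: "smooth_on X \<omega>"
    using assms(2) by (auto simp: liouville_solution_def)
  have smooth_W: "smooth_on X W"
    unfolding W_def by (rule smooth_on_linear_image[OF \<open>open X\<close> bounded_linear_of_real smooth_\<omega>])
  have smooth_exp: "smooth_on X (\<lambda>w. exp (c * W w))" for c
    by (rule smooth_on_exp[OF \<open>open X\<close>
          smooth_on_linear_image[OF \<open>open X\<close> bounded_linear_mult_right smooth_W]])
  \<comment> \<open>These identities serve to cancel the normalising factor
    \<open>exp (W z / 2)\<close> of the off-diagonal entries.\<close>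
  have exps: "exp (W z) = exp (W z / 2) * exp (W z / 2)"
      "exp (- W z / 2) * exp (W z / 2) = 1"
      "exp (- W z / 2) = exp (- W z) * exp (W z / 2)"
      "exp (W z) * exp (- W z) = 1" for z
    by (simp_all flip: exp_add)
  have K'_cases: "k = - int g - 1 \<or> k \<in> ?K" if "k \<in> ?K'" for k
    using that by auto

  \<comment> \<open>At the added index both sides vanish: the left by the degree bound in
    \<open>potentials\<close>, the right by the convention.\<close>
  have form': "\<xi> z k $ 1 $ 1 = u k z" "\<xi> z k $ 1 $ 2 = \<tau> k z * exp (W z / 2)"
      "\<xi> z k $ 2 $ 1 = \<sigma> k z * exp (W z / 2)" "\<xi> z k $ 2 $ 2 = - u k z"
    if "k \<in> ?K'" "z \<in> X" for k z
  proof -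
    have "\<xi> z (- int g - 1) = 0"
      using assms(3) that by (auto simp: finite_type_with_def potentials_def)
    moreover have "complex_of_real (exp (\<omega> z / 2)) = exp (W z / 2)"
      by (simp add: W_def flip: exp_of_real)
    ultimately show "\<xi> z k $ 1 $ 1 = u k z" "\<xi> z k $ 1 $ 2 = \<tau> k z * exp (W z / 2)"
      "\<xi> z k $ 2 $ 1 = \<sigma> k z * exp (W z / 2)" "\<xi> z k $ 2 $ 2 = - u k z"
      using K'_cases[OF that(1)] form[OF _ that(2), of k] convention[OF that(2)] by auto
  qed

  \<comment> \<open>Smoothness of the coefficient functions\<close>
  have smooth_\<xi>: "smooth_on X (\<lambda>w. \<xi> w k $ i $ j)" if "k \<in> ?K" for k i j
    using assms(3) that smooth_on_linear_image[OF \<open>open X\<close> bounded_linear_entry, of "\<lambda>w. \<xi> w k"]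
    by (auto simp: finite_type_with_def)
  have smooth: "smooth_on X (u k) \<and> smooth_on X (\<tau> k) \<and> smooth_on X (\<sigma> k)"
    if k: "k \<in> ?K" for k
  proof (intro conjI)
    show "smooth_on X (u k)"
      by (rule smooth_on_cong[OF \<open>open X\<close> smooth_\<xi>[OF k, of 1 1]]) (use k in \<open>simp add: form'(1)\<close>)
    \<comment> \<open>\<tau> and \<sigma> are recovered from the off-diagonal entries by multiplying
      with the inverse exponential, whose exponent is written as a constant times \<open>W\<close>
      to fit \<open>smooth_exp\<close>.\<close>
    have cancel: "x * exp (W z / 2) * exp (- 1 / 2 * W z) = x" for x z
      using exps(2)[of z] by (simp add: mult.commute)
    have div: "smooth_on X (\<lambda>w. \<xi> w k $ i $ j * exp (- 1 / 2 * W w))" for i j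
      by (rule smooth_on_mult[OF \<open>open X\<close> smooth_\<xi>[OF k] smooth_exp])
    show "smooth_on X (\<tau> k)"
      by (rule smooth_on_cong[OF \<open>open X\<close> div[of 1 2]])
        (use k cancel in \<open>simp add: form'\<close>)
    show "smooth_on X (\<sigma> k)"
      by (rule smooth_on_cong[OF \<open>open X\<close> div[of 2 1]])
        (use k cancel in \<open>simp add: form'\<close>)
  qed

  have diff: "W differentiable at z" "u k differentiable at z" "\<tau> k differentiable at z"
      "\<sigma> k differentiable at z"
    if "k \<in> ?K" "z \<in> X" for k z
    using smooth[OF that(1)] smooth_W that(2) by (auto intro: smooth_on_imp_differentiable)
  have diff_half: "(\<lambda>w. W w / 2) differentiable at z" if "z \<in> X" for z
    using differentiable_mult[OF diff(1)[of 1 z] differentiable_const[of "1 / 2"]] that by simp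
  have D_half: "D_z (\<lambda>w. exp (W w / 2)) z = D_z W z / 2 * exp (W z / 2)"
      "D_zbar (\<lambda>w. exp (W w / 2)) z = D_zbar W z / 2 * exp (W z / 2)"
      "(\<lambda>w. exp (W w / 2)) differentiable at z"
    if "z \<in> X" for z
  proof -
    show "D_z (\<lambda>w. exp (W w / 2)) z = D_z W z / 2 * exp (W z / 2)"
      using D_z_exp[OF diff_half[OF that]] D_z_cmult[OF diff(1), of 1 z "1/2"] that by simp
    show "D_zbar (\<lambda>w. exp (W w / 2)) z = D_zbar W z / 2 * exp (W z / 2)"
      using D_zbar_exp[OF diff_half[OF that]] D_zbar_cmult[OF diff(1), of 1 z "1/2"] that by simp
    show "(\<lambda>w. exp (W w / 2)) differentiable at z"
      using has_derivative_exp_compose[OF diff_half[OF that]] unfolding differentiable_def by blast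
  qed

  \<comment> \<open>First-order equations for u, \<tau> and \<sigma>\<close>
  note Killing = Killing_field_coefficient_equations[OF assms(3), unfolded W_apply]

  have u_z: "D_z (u k) z = - Q * \<tau> k z - exp (W z) / 4 * \<sigma> (k - 1) z"
    and u_zbar: "D_zbar (u k) z = - cnj Q * \<sigma> k z"
    if "k \<in> ?K" "z \<in> X" for k z
  proof -
    have *: "D_z (u k) z = D_z (\<lambda>w. \<xi> w k $ 1 $ 1) z" "D_zbar (u k) z = D_zbar (\<lambda>w. \<xi> w k $ 1 $ 1) z"
      by (rule D_z_cong_open[OF \<open>open X\<close> that(2)] D_zbar_cong_open[OF \<open>open X\<close> that(2)];
          use that(1) in \<open>simp add: form'\<close>)+
    show "D_z (u k) z = - Q * \<tau> k z - exp (W z) / 4 * \<sigma> (k - 1) z"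
      unfolding * D_z_eq[OF Killing(1)[OF that(2,1)]]
      using that exps(1,2)[of z] by (simp add: form') algebra
    show "D_zbar (u k) z = - cnj Q * \<sigma> k z"
      unfolding * D_zbar_eq[OF Killing(1)[OF that(2,1)]]
      using that exps(2)[of z] by (simp add: form')
  qed

  \<comment> \<open>The product rule for \<tau> times \<open>exp (W w / 2)\<close> produces half of
    a derivative of \<open>W\<close>. In the z direction it adds to the equal term from \<alpha>; in
    the conjugate direction the two cancel.\<close>
  have \<tau>_z: "u (k - 1) z = 2 * (D_z (\<tau> k) z + D_z W z * \<tau> k z)"
    and \<tau>_zbar: "D_zbar (\<tau> k) z = 2 * cnj Q * exp (- W z) * u k z"
    if "k \<in> ?K" "z \<in> X" for k z
  proof -
    have eq: "D_z (\<lambda>w. \<xi> w k $ 1 $ 2) z = D_z (\<lambda>w. \<tau> k w * exp (W w / 2)) z"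
      "D_zbar (\<lambda>w. \<xi> w k $ 1 $ 2) z = D_zbar (\<lambda>w. \<tau> k w * exp (W w / 2)) z"
      by (rule D_z_cong_open[OF \<open>open X\<close> that(2)] D_zbar_cong_open[OF \<open>open X\<close> that(2)];
          use that(1) in \<open>simp add: form'\<close>)+
    have "\<tau> k z * (D_z W z / 2 * exp (W z / 2)) + D_z (\<tau> k) z * exp (W z / 2) =
        exp (W z / 2) / 4 * (2 * u (k - 1) z) - D_z W z / 2 * (\<tau> k z * exp (W z / 2))"
      using eq(1) D_z_eq[OF Killing(2)[OF that(2,1)]] that
      by (simp add: form' D_z_mult[OF diff(3) D_half(3)] D_half)
    then have "exp (W z / 2) * u (k - 1) z = exp (W z / 2) * (2 * (D_z (\<tau> k) z + D_z W z * \<tau> k z))"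
      by algebra
    then show "u (k - 1) z = 2 * (D_z (\<tau> k) z + D_z W z * \<tau> k z)" by simp
    have "\<tau> k z * (D_zbar W z / 2 * exp (W z / 2)) + D_zbar (\<tau> k) z * exp (W z / 2) =
        D_zbar W z / 2 * (\<tau> k z * exp (W z / 2)) + cnj Q * exp (- W z / 2) * (2 * u k z)"
      using eq(2) D_zbar_eq[OF Killing(2)[OF that(2,1)]] that
      by (simp add: form' D_zbar_mult[OF diff(3) D_half(3)] D_half)
    then have "exp (W z / 2) * D_zbar (\<tau> k) z = exp (W z / 2) * (2 * cnj Q * exp (- W z) * u k z)"
      unfolding exps(3)[of z] by (simp add: algebra_simps)
    then show "D_zbar (\<tau> k) z = 2 * cnj Q * exp (- W z) * u k z" by simp
  qed

  \<comment> \<open>For \<sigma> the two directions exchange their roles. The second equation says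
    that \<open>exp (W z) * \<sigma> k z\<close> has vanishing derivative in the conjugate
    direction, which is what yields the linearised equation.\<close>
  have \<sigma>_z: "D_z (\<sigma> k) z = 2 * Q * exp (- W z) * u k z"
    and \<sigma>_zbar: "D_zbar (\<sigma> k) z = - D_zbar W z * \<sigma> k z"
    if "k \<in> ?K" "z \<in> X" for k z
  proof -
    have eq: "D_z (\<lambda>w. \<xi> w k $ 2 $ 1) z = D_z (\<lambda>w. \<sigma> k w * exp (W w / 2)) z"
      "D_zbar (\<lambda>w. \<xi> w k $ 2 $ 1) z = D_zbar (\<lambda>w. \<sigma> k w * exp (W w / 2)) z"
      by (rule D_z_cong_open[OF \<open>open X\<close> that(2)] D_zbar_cong_open[OF \<open>open X\<close> that(2)];
          use that(1) in \<open>simp add: form'\<close>)+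
    have "\<sigma> k z * (D_z W z / 2 * exp (W z / 2)) + D_z (\<sigma> k) z * exp (W z / 2) =
        D_z W z / 2 * (\<sigma> k z * exp (W z / 2)) + Q * exp (- W z / 2) * (2 * u k z)"
      using eq(1) D_z_eq[OF Killing(3)[OF that(2,1)]] that
      by (simp add: form' D_z_mult[OF diff(4) D_half(3)] D_half)
    then have "exp (W z / 2) * D_z (\<sigma> k) z = exp (W z / 2) * (2 * Q * exp (- W z) * u k z)"
      unfolding exps(3)[of z] by (simp add: algebra_simps)
    then show "D_z (\<sigma> k) z = 2 * Q * exp (- W z) * u k z" by simp
    have "\<sigma> k z * (D_zbar W z / 2 * exp (W z / 2)) + D_zbar (\<sigma> k) z * exp (W z / 2) =
        - D_zbar W z / 2 * (\<sigma> k z * exp (W z / 2))"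
      using eq(2) D_zbar_eq[OF Killing(3)[OF that(2,1)]] that
      by (simp add: form' D_zbar_mult[OF diff(4) D_half(3)] D_half)
    then have "D_zbar (\<sigma> k) z * exp (W z / 2) =
        - D_zbar W z / 2 * (\<sigma> k z * exp (W z / 2)) - \<sigma> k z * (D_zbar W z / 2 * exp (W z / 2))"
      by (simp only: eq_diff_eq add.commute)
    also have "\<dots> = exp (W z / 2) * (- D_zbar W z * \<sigma> k z)"
      by simp
    finally have "exp (W z / 2) * D_zbar (\<sigma> k) z = exp (W z / 2) * (- D_zbar W z * \<sigma> k z)"
      by (simp only: mult.commute)
    then show "D_zbar (\<sigma> k) z = - D_zbar W z * \<sigma> k z"
      by (simp only: mult_cancel_left exp_not_eq_zero simp_thms)
  qed

  \<comment> \<open>Extension of the equations to the index - g - 1\<close>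
  have bottom: "D_z (f (- int g - 1)) z = 0" "D_zbar (f (- int g - 1)) z = 0"
      "f (- int g - 1) differentiable at z"
    if "f = u \<or> f = \<sigma>" "z \<in> X" for f :: "int \<Rightarrow> complex \<Rightarrow> complex" and z
  proof -
    \<comment> \<open>The function is known to vanish only on \<open>X\<close>; since
      \<open>X\<close> is open, this still makes it differentiable there with zero
      derivatives.\<close>
    have f: "f (- int g - 1) w = 0" if "w \<in> X" for w
      using convention[OF that] \<open>f = u \<or> f = \<sigma>\<close> by auto
    show "D_z (f (- int g - 1)) z = 0" "D_zbar (f (- int g - 1)) z = 0"
      using D_z_cong_open[OF \<open>open X\<close> \<open>z \<in> X\<close> f] D_zbar_cong_open[OF \<open>open X\<close> \<open>z \<in> X\<close> f] by simp_all
    have "(f (- int g - 1) has_derivative (\<lambda>_. 0)) (at z)"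
      using has_derivative_transform_within_open[OF has_derivative_const \<open>open X\<close> \<open>z \<in> X\<close>]
      using f by metis
    then show "f (- int g - 1) differentiable at z"
      by (auto simp: differentiable_def)
  qed
  have \<sigma>_eq: "\<sigma> k z = - (1 / cnj Q) * D_zbar (u k) z" if "k \<in> ?K'" "z \<in> X" for k z
    using K'_cases[OF that(1)] u_zbar[OF _ that(2), of k] bottom(2)[of u z] convention[OF that(2)] Q that
    by auto
  have \<sigma>_zbar': "D_zbar (\<sigma> k) z = - D_zbar W z * \<sigma> k z"
    and \<sigma>_z': "D_z (\<sigma> k) z = 2 * Q * exp (- W z) * u k z"
    and diff_\<sigma>: "\<sigma> k differentiable at z"
    if "k \<in> ?K'" "z \<in> X" for k z
    using K'_cases[OF that(1)] \<sigma>_zbar[OF _ that(2), of k] \<sigma>_z[OF _ that(2), of k]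
      diff(4)[OF _ that(2), of k] bottom[of \<sigma> z] convention[OF that(2)] that by auto

  \<comment> \<open>Second derivatives of u\<close>
  have u_zz: "D_z (D_z (u k)) z =
      - Q * D_z (\<tau> k) z - exp (W z) / 4 * (D_z W z * \<sigma> (k - 1) z + D_z (\<sigma> (k - 1)) z)"
    and u_zzbar: "D_zbar (D_z (u k)) z =
      - Q * D_zbar (\<tau> k) z - exp (W z) / 4 * (D_zbar W z * \<sigma> (k - 1) z + D_zbar (\<sigma> (k - 1)) z)"
    if "k \<in> ?K" "z \<in> X" for k z
  proof -
    \<comment> \<open>The right-hand side of \<open>u_z\<close>, regrouped as a sum of constant
      multiples so that the sum, multiple and product rules apply literally.\<close>
    let ?f = "\<lambda>w. - Q * \<tau> k w + - (1 / 4) * (exp (W w) * \<sigma> (k - 1) w)"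
    have *: "D_z (u k) w = ?f w" if "w \<in> X" for w
      using u_z[OF \<open>k \<in> ?K\<close> that] by simp
    have d\<sigma>: "\<sigma> (k - 1) differentiable at z"
      using diff_\<sigma>[of "k - 1" z] that by auto
    have dW: "W differentiable at z"
      using diff(1)[OF that] .
    then have dE: "(\<lambda>w. exp (W w)) differentiable at z"
      using has_derivative_exp_compose differentiable_def by blast
    have d1: "(\<lambda>w. - Q * \<tau> k w) differentiable at z"
      by (rule differentiable_mult[OF differentiable_const diff(3)[OF that]])
    have d2: "(\<lambda>w. exp (W w) * \<sigma> (k - 1) w) differentiable at z"
      using dE d\<sigma> by (rule differentiable_mult)
    have d3: "(\<lambda>w. - (1 / 4) * (exp (W w) * \<sigma> (k - 1) w)) differentiable at z"
      by (rule differentiable_mult[OF differentiable_const d2])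
    have cong: "D_z (D_z (u k)) z = D_z ?f z" "D_zbar (D_z (u k)) z = D_zbar ?f z"
      by (rule D_z_cong_open[OF \<open>open X\<close> that(2) *] D_zbar_cong_open[OF \<open>open X\<close> that(2) *];
          assumption)+
    show "D_z (D_z (u k)) z =
        - Q * D_z (\<tau> k) z - exp (W z) / 4 * (D_z W z * \<sigma> (k - 1) z + D_z (\<sigma> (k - 1)) z)"
      unfolding cong D_z_add[OF d1 d3] D_z_cmult[OF diff(3)[OF that]]
        D_z_cmult[OF d2] D_z_mult[OF dE d\<sigma>] D_z_exp[OF dW]
      by (simp add: field_simps)
    show "D_zbar (D_z (u k)) z =
        - Q * D_zbar (\<tau> k) z - exp (W z) / 4 * (D_zbar W z * \<sigma> (k - 1) z + D_zbar (\<sigma> (k - 1)) z)"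
      unfolding cong D_zbar_add[OF d1 d3] D_zbar_cmult[OF diff(3)[OF that]]
        D_zbar_cmult[OF d2] D_zbar_mult[OF dE d\<sigma>] D_zbar_exp[OF dW]
      by (simp add: field_simps)
  qed

  \<comment> \<open>Initial values, the formula for the z-derivative of \<tau>, and the linearised
    equation\<close>
  have exp_W: "complex_of_real (exp (- \<omega> z)) = exp (- W z)" for z
    by (simp add: W_def flip: exp_of_real)
  have "\<tau> 1 z = 1 / 4 \<and> u 1 z = 0 \<and> \<sigma> 1 z = 0" if "z \<in> X" for z
  proof -
    have "\<xi> z 1 = mat22 0 (of_real (exp (\<omega> z / 2) / 4)) 0 0"
      using assms(3) that by (simp add: finite_type_with_def)
    moreover have "complex_of_real (exp (\<omega> z / 2) / 4) = 1 / 4 * exp (W z / 2)"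
      by (simp add: W_def flip: exp_of_real)
    ultimately show ?thesis
      using form'[of 1 z] that by simp
  qed
  moreover have "D_z (\<tau> k) z = - (1 / (2 * Q)) * (D_z (D_z (u k)) z - D_z W z * D_z (u k) z)"
    if "k \<in> ?K" "z \<in> X" for k z
  proof -
    \<comment> \<open>The index k - 1 can be - g - 1, so the extended form
      \<open>\<sigma>_z'\<close> is needed.\<close>
    have \<sigma>': "D_z (\<sigma> (k - 1)) z = 2 * Q * exp (- W z) * u (k - 1) z"
      using \<sigma>_z'[of "k - 1" z] that by auto
    \<comment> \<open>Subtracting the multiple of \<open>D_z (u k) z\<close> removes
      \<open>\<sigma> (k - 1)\<close>. The exponentials cancel in the term with its derivative,
      leaving - Q / 2 times \<open>u (k - 1) z\<close>; by \<open>\<tau>_z\<close> this provides a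
      second copy of - Q times \<open>D_z (\<tau> k) z\<close>, and the terms with
      \<open>D_z W z * \<tau> k z\<close> cancel.\<close>
    have "D_z (D_z (u k)) z - D_z W z * D_z (u k) z = - (2 * Q) * D_z (\<tau> k) z"
      using u_zz[OF that] u_z[OF that] \<tau>_z[OF that] \<sigma>' exps(4)[of z] by algebra
    then show ?thesis using Q by simp
  qed
  moreover have "D_zbar (D_z (u k)) z + 2 * of_real ((cmod Q)\<^sup>2 * exp (- \<omega> z)) * u k z = 0"
    if "k \<in> ?K" "z \<in> X" for k z
  proof -
    have "D_zbar (\<sigma> (k - 1)) z = - D_zbar W z * \<sigma> (k - 1) z"
      using \<sigma>_zbar'[of "k - 1" z] that by auto
    \<comment> \<open>The bracket in \<open>u_zzbar\<close> vanishes by the preceding equation, so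
      only - Q times \<open>D_zbar (\<tau> k) z\<close> survives.\<close>
    then have "D_zbar (D_z (u k)) z = - 2 * (Q * cnj Q) * exp (- W z) * u k z"
      using u_zzbar[OF that] \<tau>_zbar[OF that] by simp
    then show ?thesis
      by (simp add: exp_W complex_norm_square flip: of_real_power)
  qed
  ultimately show ?thesis
    using smooth \<tau>_z \<tau>_zbar \<sigma>_eq unfolding W_def[symmetric] exp_W by auto
qed

end
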